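(* Consider the infinite time horizon case. Suppose that $C(x+1_s)-C(x)\le \bar d+r$ for all $x\in X$ and all $s\in F(x)$. Then the unique fixed point of the dynamic program $V_{t-1}=\mathcal{T}V_t$ (i.e. the unique function $V^*$ with $V^*=\mathcal{T}V^*$, among functions $V:X\to\mathbb{R}$ with the boundary value $V(\bar x)=-C(\bar x)$ shared by all value functions of the problem) is given by $$V^{*}(x)= (\bar d+r)\,\mathbf{1}^{\intercal}(\bar x-x)-C(\bar x)\quad\text{for all } x\in X .$$
   Context: Setting. Let $S=\{1,\dots,\bar s\}$ be the set of delivery slots and $\bar x\in\mathbb{Z}^{\bar s}$ a vector of nonnegative integer capacities. Let $X=\{x\in\mathbb{Z}^{\bar s}: 0\le x_s\le \bar x_s \text{ for all } s\in S\}$. For $s\in S$, $1_s$ is the $s$-th unit vector in $\mathbb{Z}^{\bar s}$, and $\mathbf 1$ is the all-ones vector. The set of feasible slots at $x\in X$ is $F(x)=\{s\in S: x+1_s\in X\}$. Let $r\in\mathbb{R}$ (expected net revenue of an order), let $\underline d\le\bar d$ be real numbers (minimum and maximum delivery charge), and let $\lambda\in(0,1)$ (arrival rate). The delivery cost is $C(x)=C_{\mathbb{R}_+}(x)$ for $x\in X$, where $C_{\mathbb{R}_+}:X\to\mathbb{R}_+$ is a given function, and $C(x)=\infty$ for $x\notin X$. Customer choice model. Each slot $s$ has a charge $d_s\in[\underline d,\bar d]\cup\{\infty\}$, where $d_s=\infty$ means that slot $s$ is not offered. Given a charge vector $d=(d_1,\dots,d_{\bar s})$, a customer chooses slot $s$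 with probability $\Pi_s(d)\in[0,1)$, and chooses no slot with probability $\Pi_0(d)>0$, where $\sum_{s\in S}\Pi_s(d)=1-\Pi_0(d)$. No particular form of the choice model is assumed; it is required only that it is a probability distribution and that, for all $s\in S$, $\Pi_s(d)$ tends to zero with a faster than linear rate of convergence as $d_s\to\infty$ (so that a slot which is not offered is chosen with probability $0$). Put $p_s(d)=\lambda\Pi_s(d)$. Dynamic programming operator. For $x\in X$ let $D(x)$ be the set of charge vectors with $d_s\in[\underline d,\bar d]$ for $s\in F(x)$ and $d_s=\infty$ for $s\notin F(x)$. For $V:X\to\mathbb{R}$ define $$(\mathcal{T}V)(x)=\max_{d\in D(x)}\Big\{\sum_{s\in S}p_s(d)\big[r+d_s+V(x+1_s)-V(x)\big]+V(x)\Big\},\quad x\in X,$$ where the terms with $s\notin F(x)$ (for which $p_s(d)=0$) are taken to be $0$. The value functions of the problem are generated by $V_{t-1}=\mathcal{T}V_t$, backwards in time from the terminal condition equal to $-C$ on $X$; in the infinite horizon case the number $\bar t$ of time steps tends to infinity. Since no slot is feasible at $\bar x$, all value functions satisfy $V_t(\bar x)=-C(\bar x)$.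
   Formalization: Added assumption: whenever some slot is feasible at x, the no-slot probability satisfies Π_0(d)<1 for all d in D(x); without it (e.g. Π_s≡0, Π_0≡1) every V satisfies V=TV and uniqueness fails. *)

theory Defs
  imports "HOL-Analysis.Analysis" "HOL-Library.Landau_Symbols"
begin

text \<open>
  The slots are the elements of a finite type. States and capacities are integer vectors over it,
  and \<^term>\<open>axis s 1\<close> is the unit vector of slot \<^term>\<open>s\<close>.
\<close>

definition states :: "int ^ 's \<Rightarrow> (int ^ 's) set" where
  "states xbar = {x. \<forall>s. 0 \<le> x $ s \<and> x $ s \<le> xbar $ s}"

definition feasible :: "int ^ 's \<Rightarrow> int ^ 's \<Rightarrow> 's::finite set" where
  "feasible xbar x = {s. x + axis s 1 \<in> states xbar}"

definition delivery_cost :: "int ^ 's \<Rightarrow> (int ^ 's \<Rightarrow> real) \<Rightarrow> int ^ 's \<Rightarrow> ereal" where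
  "delivery_cost xbar C\<^sub>R x = (if x \<in> states xbar then ereal (C\<^sub>R x) else \<infinity>)"

text \<open>The charge \<open>\<infinity>\<close> means that the slot is not offered.\<close>

definition charge_vectors :: "real \<Rightarrow> real \<Rightarrow> ('s \<Rightarrow> ereal) set" where
  "charge_vectors dmin dmax = {d. \<forall>s. d s \<in> {ereal dmin..ereal dmax} \<union> {\<infinity>}}"

text \<open>
  \<open>P0 d\<close> is the probability that no slot is chosen. Convergence to zero faster than linear as
  the charge of slot \<open>s\<close> grows is read as \<open>P s d = o(1 / d s)\<close>, the other charges being fixed;
  for this, \<open>P s\<close> is also evaluated at charges above \<open>dmax\<close>.
\<close>

definition choice_model ::
  "real \<Rightarrow> real \<Rightarrow> (('s::finite \<Rightarrow> ereal) \<Rightarrow> real) \<Rightarrow> ('s \<Rightarrow> ('s \<Rightarrow> ereal) \<Rightarrow> real) \<Rightarrow> bool" where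
  "choice_model dmin dmax P0 P \<longleftrightarrow>
     (\<forall>d \<in> charge_vectors dmin dmax.
        P0 d > 0 \<and>
        (\<forall>s. 0 \<le> P s d \<and> P s d < 1) \<and>
        (\<Sum>s\<in>UNIV. P s d) = 1 - P0 d \<and>
        (\<forall>s. (\<lambda>t. P s (d(s := ereal t))) \<in> o[at_top](\<lambda>t. 1 / t)) \<and>
        (\<forall>s. d s = \<infinity> \<longrightarrow> P s d = 0))"

definition decisions :: "int ^ 's \<Rightarrow> real \<Rightarrow> real \<Rightarrow> int ^ 's \<Rightarrow> ('s::finite \<Rightarrow> ereal) set" where
  "decisions xbar dmin dmax x =
     {d. (\<forall>s \<in> feasible xbar x. d s \<in> {ereal dmin..ereal dmax}) \<and>
         (\<forall>s. s \<notin> feasible xbar x \<longrightarrow> d s = \<infinity>)}"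

definition dp_objective ::
  "int ^ 's \<Rightarrow> real \<Rightarrow> real \<Rightarrow> ('s::finite \<Rightarrow> ('s \<Rightarrow> ereal) \<Rightarrow> real) \<Rightarrow>
   (int ^ 's \<Rightarrow> real) \<Rightarrow> int ^ 's \<Rightarrow> ('s \<Rightarrow> ereal) \<Rightarrow> real" where
  "dp_objective xbar r lam P V x d =
     (\<Sum>s \<in> feasible xbar x. lam * P s d * (r + real_of_ereal (d s) + V (x + axis s 1) - V x)) + V x"

definition dp_operator ::
  "int ^ 's \<Rightarrow> real \<Rightarrow> real \<Rightarrow> real \<Rightarrow> real \<Rightarrow> ('s::finite \<Rightarrow> ('s \<Rightarrow> ereal) \<Rightarrow> real) \<Rightarrow>
   (int ^ 's \<Rightarrow> real) \<Rightarrow> int ^ 's \<Rightarrow> real" where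
  "dp_operator xbar r dmin dmax lam P V x =
     (GREATEST v. v \<in> dp_objective xbar r lam P V x ` decisions xbar dmin dmax x)"

text \<open>
  \<^const>\<open>dp_operator\<close> is unspecified where the maximum is not attained (the choice model need not
  be continuous), so the equation \<open>V = T V\<close> includes the existence of a maximizer.
\<close>

definition dp_fixed_point ::
  "int ^ 's \<Rightarrow> real \<Rightarrow> real \<Rightarrow> real \<Rightarrow> real \<Rightarrow> ('s::finite \<Rightarrow> ('s \<Rightarrow> ereal) \<Rightarrow> real) \<Rightarrow>
   (int ^ 's \<Rightarrow> real) \<Rightarrow> bool" where
  "dp_fixed_point xbar r dmin dmax lam P V \<longleftrightarrow>
     (\<forall>x \<in> states xbar.
        (\<exists>d. is_arg_max (dp_objective xbar r lam P V x) (\<lambda>d. d \<in> decisions xbar dmin dmax x) d) \<and>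
        V x = dp_operator xbar r dmin dmax lam P V x)"

end

theory Submission imports Defs begin

text \<open>
  Along \<open>V\<^sup>*\<close> every accepted order changes the value by \<open>-(dmax + r)\<close>, so the objective at \<open>d\<close> is
  \<open>V\<^sup>* x\<close> plus a weighted sum of the terms \<open>d s - dmax \<le> 0\<close>, which vanishes when every feasible
  slot is charged \<open>dmax\<close>. For another fixed point \<open>V\<close>, induct on the remaining capacity: if
  \<open>V = V\<^sup>*\<close> at all successors of \<open>x\<close>, then the gains are \<open>d s - dmax - (V x - V\<^sup>* x)\<close>, and their
  weighted sum has maximum 0. Since an order arrives with positive probability, \<open>V x < V\<^sup>* x\<close> would
  make the sum positive at the maximal charges, and \<open>V x > V\<^sup>* x\<close> would make it negative everywhere.
\<close>

text \<open>\<open>GREATEST\<close> denotes the maximum only if it is attained. The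
  \<open>is_arg_max\<close> conjunct guarantees this, so the equation splits into an attained value
  and an upper bound. The two halves serve separately below.\<close>

lemma dp_fixed_point_iff:
  "dp_fixed_point xbar r dmin dmax lam P V \<longleftrightarrow>
     (\<forall>x\<in>states xbar.
        (\<exists>d\<in>decisions xbar dmin dmax x. dp_objective xbar r lam P V x d = V x) \<and>
        (\<forall>d\<in>decisions xbar dmin dmax x. dp_objective xbar r lam P V x d \<le> V x))"
proof -
  have "((\<exists>d. is_arg_max (dp_objective xbar r lam P V x) (\<lambda>d. d \<in> decisions xbar dmin dmax x) d) \<and>
         V x = dp_operator xbar r dmin dmax lam P V x) \<longleftrightarrow>
        ((\<exists>d\<in>decisions xbar dmin dmax x. dp_objective xbar r lam P V x d = V x) \<and>
         (\<forall>d\<in>decisions xbar dmin dmax x. dp_objective xbar r lam P V x d \<le> V x))"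
    (is "?L \<longleftrightarrow> ?R") for x
  proof -
    let ?D = "decisions xbar dmin dmax x" and ?f = "dp_objective xbar r lam P V x"
    have greatest: "dp_operator xbar r dmin dmax lam P V x = ?f d"
      if "d \<in> ?D" "\<forall>d'\<in>?D. ?f d' \<le> ?f d" for d
      unfolding dp_operator_def by (rule Greatest_equality) (use that in auto)
    show ?thesis
    proof
      assume ?L
      then obtain d where "is_arg_max ?f (\<lambda>d. d \<in> ?D) d" and V: "V x = dp_operator xbar r dmin dmax lam P V x"
        by blast
      then have d: "d \<in> ?D" "\<forall>d'\<in>?D. ?f d' \<le> ?f d"
        by (auto simp: is_arg_max_linorder)
      with greatest V show ?R by auto
    next
      assume ?R
      then obtain d where d: "d \<in> ?D" "?f d = V x" "\<forall>d'\<in>?D. ?f d' \<le> ?f d"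
        by auto
      then have "is_arg_max ?f (\<lambda>d. d \<in> ?D) d"
        by (auto simp: is_arg_max_linorder)
      with greatest d show ?L by auto
    qed
  qed
  then show ?thesis
    unfolding dp_fixed_point_def by blast
qed

lemma feasible_nonempty:
  fixes xbar x :: "int ^ 's::finite"
  assumes "x \<in> states xbar" "x \<noteq> xbar"
  shows "feasible xbar x \<noteq> {}"
proof -
  obtain s where "x $ s \<noteq> xbar $ s"
    using assms(2) by (auto simp: vec_eq_iff)
  then have "x $ s + 1 \<le> xbar $ s"
    using assms(1) by (simp add: states_def order_less_le zless_imp_add1_zle)
  then have "x + axis s 1 \<in> states xbar"
    using assms(1) by (auto simp: states_def axis_def)
  then show ?thesis
    by (auto simp: feasible_def)
qed

lemma decisions_subset_charge_vectors:
  "decisions xbar dmin dmax x \<subseteq> charge_vectors dmin dmax"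
  by (auto simp: decisions_def charge_vectors_def)

lemma max_charge_in_decisions:
  assumes "dmin \<le> dmax"
  shows "(\<lambda>s. if s \<in> feasible xbar x then ereal dmax else \<infinity>) \<in> decisions xbar dmin dmax x"
  using assms by (auto simp: decisions_def)

lemma decisions_charge_le:
  assumes "d \<in> decisions xbar dmin dmax x" "s \<in> feasible xbar x"
  shows "real_of_ereal (d s) \<le> dmax"
  using assms by (cases "d s") (auto simp: decisions_def)

lemma choice_model_nonneg:
  assumes "choice_model dmin dmax P0 P" "d \<in> decisions xbar dmin dmax x"
  shows "0 \<le> P s d"
  using assms decisions_subset_charge_vectors unfolding choice_model_def by blast

text \<open>Infeasible slots carry the charge \<open>\<infinity>\<close> and so have probability 0;
  the feasible slots therefore carry the full probability of an order.\<close>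

lemma choice_model_sum_feasible:
  assumes "choice_model dmin dmax P0 P" "d \<in> decisions xbar dmin dmax x"
  shows "(\<Sum>s\<in>feasible xbar x. P s d) = 1 - P0 d"
proof -
  have d: "d \<in> charge_vectors dmin dmax"
    using assms(2) decisions_subset_charge_vectors by blast
  have "P s d = 0" if "s \<notin> feasible xbar x" for s
    using assms d that unfolding choice_model_def decisions_def by blast
  then have "(\<Sum>s\<in>feasible xbar x. P s d) = (\<Sum>s\<in>UNIV. P s d)"
    by (intro sum.mono_neutral_left) auto
  also have "\<dots> = 1 - P0 d"
    using assms(1) d unfolding choice_model_def by blast
  finally show ?thesis .
qed

text \<open>Applied both to the closed form itself and to a fixed point that agrees with it at all
  successors of \<open>x\<close>: in each case the increment is the same for every feasible
  slot.\<close>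

lemma dp_objective_constant_opportunity_cost:
  assumes "\<forall>s\<in>feasible xbar x. V (x + axis s 1) - V x = c"
  shows "dp_objective xbar r lam P V x d =
    (\<Sum>s\<in>feasible xbar x. lam * P s d * (r + real_of_ereal (d s) + c)) + V x"
  unfolding dp_objective_def
  using assms by (intro arg_cong2[of _ _ _ _ "(+)"] sum.cong) (auto simp: algebra_simps)

text \<open>The claimed \<open>V\<^sup>*\<close>, with \<open>a\<close> for \<open>dmax + r\<close>
  and \<open>c\<close> for the cost at \<open>xbar\<close>.\<close>

definition max_charge_value :: "int ^ 's::finite \<Rightarrow> real \<Rightarrow> real \<Rightarrow> int ^ 's \<Rightarrow> real" where
  "max_charge_value xbar a c x = a * real_of_int (\<Sum>s\<in>UNIV. (xbar - x) $ s) - c"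

lemma sum_remaining_axis:
  fixes xbar x :: "int ^ 's::finite"
  shows "(\<Sum>t\<in>UNIV. (xbar - (x + axis s 1)) $ t) = (\<Sum>t\<in>UNIV. (xbar - x) $ t) - 1"
proof -
  have "(\<Sum>t\<in>UNIV. axis s (1::int) $ t) = 1"
    by (simp add: axis_def)
  then show ?thesis
    by (simp add: sum_subtractf sum.distrib)
qed

lemma max_charge_value_axis:
  "max_charge_value xbar a c (x + axis s 1) = max_charge_value xbar a c x - a"
  unfolding max_charge_value_def sum_remaining_axis by (simp add: algebra_simps)

text \<open>The objective sees only differences of values in its gains, so the additive constant
  \<open>c\<close> is arbitrary here; the boundary condition selects it.\<close>

lemma max_charge_value_fixed_point:
  assumes "dmin \<le> dmax" "0 < lam" "choice_model dmin dmax P0 P"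
  shows "dp_fixed_point xbar r dmin dmax lam P (max_charge_value xbar (dmax + r) c)"
proof -
  let ?W = "max_charge_value xbar (dmax + r) c"
  have obj: "dp_objective xbar r lam P ?W x d =
      (\<Sum>s\<in>feasible xbar x. lam * P s d * (real_of_ereal (d s) - dmax)) + ?W x" for x d
    by (subst dp_objective_constant_opportunity_cost[where c = "- (dmax + r)"])
      (auto simp: max_charge_value_axis algebra_simps)
  show ?thesis
    unfolding dp_fixed_point_iff
  proof (intro ballI conjI)
    fix x
    let ?d = "\<lambda>s. if s \<in> feasible xbar x then ereal dmax else \<infinity>"
    have "dp_objective xbar r lam P ?W x ?d = ?W x"
      unfolding obj by simp
    with max_charge_in_decisions[OF assms(1)]
    show "\<exists>d\<in>decisions xbar dmin dmax x. dp_objective xbar r lam P ?W x d = ?W x"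
      by blast
  next
    fix x d
    assume d: "d \<in> decisions xbar dmin dmax x"
    have "(\<Sum>s\<in>feasible xbar x. lam * P s d * (real_of_ereal (d s) - dmax)) \<le> 0"
      using assms(2) choice_model_nonneg[OF assms(3) d] decisions_charge_le[OF d]
      by (intro sum_nonpos mult_nonneg_nonpos) auto
    then show "dp_objective xbar r lam P ?W x d \<le> ?W x"
      unfolding obj by simp
  qed
qed

lemma dp_fixed_point_determined_by_successors:
  assumes "dmin \<le> dmax" "0 < lam" "choice_model dmin dmax P0 P"
    and order: "\<forall>d\<in>decisions xbar dmin dmax x. P0 d < 1"
    and fp: "dp_fixed_point xbar r dmin dmax lam P V"
    and x: "x \<in> states xbar"
    and succ: "\<forall>s\<in>feasible xbar x.
      V (x + axis s 1) = max_charge_value xbar (dmax + r) c (x + axis s 1)"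
  shows "V x = max_charge_value xbar (dmax + r) c x"
proof -
  define \<delta> where "\<delta> = V x - max_charge_value xbar (dmax + r) c x"
  have obj: "dp_objective xbar r lam P V x d =
      (\<Sum>s\<in>feasible xbar x. lam * P s d * (real_of_ereal (d s) - dmax - \<delta>)) + V x" for d
    \<comment> \<open>By \<open>succ\<close>, the increment is the closed form at \<open>x\<close>
      minus \<open>dmax + r\<close> minus \<open>V x\<close>, and \<open>V x\<close> exceeds the
      closed form by \<open>\<delta>\<close>.\<close>
    by (subst dp_objective_constant_opportunity_cost[where c = "- (dmax + r) - \<delta>"])
      (auto simp: succ max_charge_value_axis \<delta>_def algebra_simps)
  have const: "(\<Sum>s\<in>feasible xbar x. lam * P s d * (- \<delta>)) = - \<delta> * (lam * (1 - P0 d))"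
    if "d \<in> decisions xbar dmin dmax x" for d
    unfolding choice_model_sum_feasible[OF assms(3) that, symmetric]
    by (simp add: sum_distrib_left sum_negf mult_ac)
  have "\<not> \<delta> < 0"
  proof
    assume "\<delta> < 0"
    let ?d = "\<lambda>s. if s \<in> feasible xbar x then ereal dmax else \<infinity>"
    have d: "?d \<in> decisions xbar dmin dmax x"
      by (rule max_charge_in_decisions[OF assms(1)])
    have "dp_objective xbar r lam P V x ?d = - \<delta> * (lam * (1 - P0 ?d)) + V x"
      unfolding obj const[OF d, symmetric] by simp
    \<comment> \<open>Strictness comes from \<open>order\<close>: the order probability
      \<open>1 - P0 ?d\<close> is positive.\<close>
    moreover have "0 < - \<delta> * (lam * (1 - P0 ?d))"
      using \<open>\<delta> < 0\<close> assms(2) order d by (intro mult_pos_pos) auto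
    moreover have "dp_objective xbar r lam P V x ?d \<le> V x"
      using fp x d unfolding dp_fixed_point_iff by blast
    ultimately show False by linarith
  qed
  moreover have "\<not> \<delta> > 0"
  proof
    assume "\<delta> > 0"
    obtain d where d: "d \<in> decisions xbar dmin dmax x" and "dp_objective xbar r lam P V x d = V x"
      using fp x unfolding dp_fixed_point_iff by blast
    then have "(\<Sum>s\<in>feasible xbar x. lam * P s d * (real_of_ereal (d s) - dmax - \<delta>)) = 0"
      unfolding obj by simp
    \<comment> \<open>The maximizer may charge less than \<open>dmax\<close>, but this only lowers
      the sum.\<close>
    moreover have "(\<Sum>s\<in>feasible xbar x. lam * P s d * (real_of_ereal (d s) - dmax - \<delta>))
        \<le> (\<Sum>s\<in>feasible xbar x. lam * P s d * (- \<delta>))"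
      using assms(2) choice_model_nonneg[OF assms(3) d] decisions_charge_le[OF d]
      by (intro sum_mono mult_left_mono) auto
    moreover have "0 < \<delta> * (lam * (1 - P0 d))"
      using \<open>\<delta> > 0\<close> assms(2) order d by (intro mult_pos_pos) auto
    ultimately show False
      unfolding const[OF d] by linarith
  qed
  ultimately show ?thesis
    by (simp add: \<delta>_def)
qed

lemma dp_fixed_point_unique:
  assumes "dmin \<le> dmax" "0 < lam" "choice_model dmin dmax P0 P"
    and order: "\<forall>x\<in>states xbar. feasible xbar x \<noteq> {} \<longrightarrow>
      (\<forall>d\<in>decisions xbar dmin dmax x. P0 d < 1)"
    and fp: "dp_fixed_point xbar r dmin dmax lam P V"
    and boundary: "V xbar = - c"
    and "x \<in> states xbar"
  shows "V x = max_charge_value xbar (dmax + r) c x"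
  using \<open>x \<in> states xbar\<close>
proof (induction "nat (\<Sum>t\<in>UNIV. (xbar - x) $ t)" arbitrary: x rule: less_induct)
  case less
  show ?case
  proof (cases "x = xbar")
    \<comment> \<open>No slot is feasible at \<open>xbar\<close>, so the fixed point equation is
      vacuous there and the value comes from the boundary condition.\<close>
    case True
    then show ?thesis
      using boundary by (simp add: max_charge_value_def)
  next
    case False
    have "V (x + axis s 1) = max_charge_value xbar (dmax + r) c (x + axis s 1)"
      if s: "s \<in> feasible xbar x" for s
    proof (rule less.hyps)
      show succ: "x + axis s 1 \<in> states xbar"
        using s by (simp add: feasible_def)
      \<comment> \<open>\<open>nat\<close> truncates at 0, so the drop by 1 is strict only because
        the successor's remaining capacity is nonnegative.\<close>
      have "0 \<le> (\<Sum>t\<in>UNIV. (xbar - (x + axis s 1)) $ t)"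
        using succ by (intro sum_nonneg) (auto simp: states_def)
      then show "nat (\<Sum>t\<in>UNIV. (xbar - (x + axis s 1)) $ t) < nat (\<Sum>t\<in>UNIV. (xbar - x) $ t)"
        unfolding sum_remaining_axis by linarith
    qed
    moreover have "\<forall>d\<in>decisions xbar dmin dmax x. P0 d < 1"
      using order less.prems feasible_nonempty[OF less.prems False] by blast
    ultimately show ?thesis
      using dp_fixed_point_determined_by_successors[OF assms(1-3) _ fp less.prems] by blast
  qed
qed

theorem theorem1:
  fixes xbar :: "int ^ 's::finite"
    and r dmin dmax lam :: real
    and C\<^sub>R :: "int ^ 's \<Rightarrow> real"
    and P0 :: "('s \<Rightarrow> ereal) \<Rightarrow> real"
    and P :: "'s \<Rightarrow> ('s \<Rightarrow> ereal) \<Rightarrow> real"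
  assumes "\<forall>s. 0 \<le> xbar $ s"
    and "dmin \<le> dmax"
    and "0 < lam" and "lam < 1"
    and "\<forall>x \<in> states xbar. 0 \<le> C\<^sub>R x"
    and "choice_model dmin dmax P0 P"
    and nondegenerate: "\<forall>x \<in> states xbar. feasible xbar x \<noteq> {} \<longrightarrow>
           (\<forall>d \<in> decisions xbar dmin dmax x. P0 d < 1)"
    and "\<forall>x \<in> states xbar. \<forall>s \<in> feasible xbar x.
           delivery_cost xbar C\<^sub>R (x + axis s 1) - delivery_cost xbar C\<^sub>R x \<le> ereal (dmax + r)"
  shows "\<exists>Vstar :: int ^ 's \<Rightarrow> real.
      (\<forall>x \<in> states xbar. ereal (Vstar x) =
         ereal ((dmax + r) * real_of_int (\<Sum>s\<in>UNIV. (xbar - x) $ s)) - delivery_cost xbar C\<^sub>R xbar) \<and>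
      dp_fixed_point xbar r dmin dmax lam P Vstar \<and>
      ereal (Vstar xbar) = - delivery_cost xbar C\<^sub>R xbar \<and>
      (\<forall>V :: int ^ 's \<Rightarrow> real.
         dp_fixed_point xbar r dmin dmax lam P V \<and> ereal (V xbar) = - delivery_cost xbar C\<^sub>R xbar
         \<longrightarrow> (\<forall>x \<in> states xbar. V x = Vstar x))"
proof -
  \<comment> \<open>Nonnegative capacities put \<open>xbar\<close> among the states, so its cost is
    finite and the \<open>ereal\<close> equations reduce to real ones.\<close>
  have cost: "delivery_cost xbar C\<^sub>R xbar = ereal (C\<^sub>R xbar)"
    using assms(1) by (simp add: delivery_cost_def states_def)
  let ?W = "max_charge_value xbar (dmax + r) (C\<^sub>R xbar)"
  show ?thesis
  proof (intro exI[of _ ?W] conjI allI ballI impI)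
    show "dp_fixed_point xbar r dmin dmax lam P ?W"
      using max_charge_value_fixed_point[OF assms(2,3,6)] .
  next
    fix V x
    assume "dp_fixed_point xbar r dmin dmax lam P V \<and> ereal (V xbar) = - delivery_cost xbar C\<^sub>R xbar"
      and "x \<in> states xbar"
    then show "V x = ?W x"
      using dp_fixed_point_unique[OF assms(2,3,6) nondegenerate] by (simp add: cost)
  qed (simp_all add: cost max_charge_value_def)
qed

end
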